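(* Let $m\geq 1$ and let $f(x;\mathbf{y})\in\mathbb{Z}[x,y_1,\dots,y_m]$ have the form $f(x;\mathbf{y})=c_0(\mathbf{y})x^d+\dots+c_d(\mathbf{y})$ with $c_0,\dots,c_d\in\mathbb{Z}[\mathbf{y}]$ and $c_0$ not identically zero. Let $\mathcal{A}\subset\mathbb{Z}^m$, and let $w:\mathbb{Z}^m\to\mathbb{R}_{\geq 0}$ satisfy $\sum_{\mathbf{n}\in\mathbb{Z}^m}w(\mathbf{n})<\infty$. Let $\mathcal{P}$ be a finite non-empty set of primes with $P=\#\mathcal{P}$, let $\alpha\in\mathbb{Z}_{>0}$ and let $g\in\mathbb{Z}[\mathbf{y}]$ be a non-zero polynomial. For $\mathbf{n}\in\mathbb{Z}^m$ and primes $p$ put $h(\mathbf{n})=\gcd(c_0(\mathbf{n}),\dots,c_d(\mathbf{n}))$ and $\nu_p(\mathbf{n})=\#\{x \bmod p: f(x;\mathbf{n})\equiv 0\bmod p\}$. Suppose that $w(\mathbf{n})=0$ whenever $g(\mathbf{n})h(\mathbf{n})=0$ or $|\mathbf{n}|\geq \exp(P)$. Define $$S(\mathcal{A})=\sum_{\substack{\mathbf{n}\in\mathcal{A}\\ \exists x\in\mathbb{Z}:\ f(x;\mathbf{n})=0}} w(\mathbf{n}).$$ Then $$S(\mathcal{A})\ll \frac{1}{P^2}\sum_{p,q\in\mathcal{P}}\Big|\sum_{i,j\in\{0,1,2\}} c_{i,j}(\alpha)S_{i,j}(p,q)\Big|,$$ where the implied constant depends only on $f$ and $g$, $$S_{i,j}(p,q)=\sum_{\substack{\mathbf{n}\in\mathcal{A}\\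 \gcd(pq,g(\mathbf{n})h(\mathbf{n}))=1}} w(\mathbf{n})\nu_p(\mathbf{n})^i\nu_q(\mathbf{n})^j,$$ and $c_{0,0}(\alpha)=(\alpha-d)^2$; $c_{1,0}(\alpha)=c_{0,1}(\alpha)=\alpha+(\alpha-1)d-d^2$; $c_{1,1}(\alpha)=(1+d)^2$; $c_{2,0}(\alpha)=c_{0,2}(\alpha)=-\alpha+d$; $c_{2,1}(\alpha)=c_{1,2}(\alpha)=-1-d$; $c_{2,2}(\alpha)=1$.
   Context: $|\mathbf{n}|$ denotes a norm on $\mathbb{Z}^m$ (e.g. the maximum of the absolute values of the coordinates).
   Formalization: The bound is proved for P at least a threshold depending only on f, g and the norm; for small P it is false as stated (f=x, g=2, the set of primes {2}, α=1, A={0}, w the indicator of 0 gives S(A)=1 and right-hand side 0). *)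

theory Defs
  imports
    "HOL-Analysis.Analysis"
    "HOL-Library.Poly_Mapping"
    "HOL-Computational_Algebra.Polynomial"
    "HOL-Computational_Algebra.Primes"
begin

text \<open>
  The polynomial ring \<open>\<int>[y\<^sub>1, \<dots>, y\<^sub>m]\<close>, with the variables indexed by a finite type \<open>'m\<close>:
  finitely supported maps from exponent vectors to integers, with the convolution product
  of \<^theory>\<open>HOL-Library.Poly_Mapping\<close>. An element of \<open>\<int>[x, y\<^sub>1, \<dots>, y\<^sub>m]\<close> is taken as a
  polynomial in \<open>x\<close> over this ring.
\<close>

type_synonym 'm zpoly = "('m \<Rightarrow>\<^sub>0 nat) \<Rightarrow>\<^sub>0 int"

definition zeval :: "'m::finite zpoly \<Rightarrow> int ^ 'm \<Rightarrow> int" where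
  "zeval p n = (\<Sum>e\<in>Poly_Mapping.keys p. Poly_Mapping.lookup p e * (\<Prod>i\<in>UNIV. (n $ i) ^ Poly_Mapping.lookup e i))"

definition specialise :: "'m::finite zpoly poly \<Rightarrow> int ^ 'm \<Rightarrow> int poly" where
  "specialise f n = map_poly (\<lambda>c. zeval c n) f"

text \<open>A norm on \<open>\<int>\<^sup>m\<close> is the restriction of a norm on \<open>\<real>\<^sup>m\<close>.\<close>

definition is_norm :: "('a::real_vector \<Rightarrow> real) \<Rightarrow> bool" where
  "is_norm N \<longleftrightarrow>
     (\<forall>v. N v = 0 \<longleftrightarrow> v = 0) \<and>
     (\<forall>r v. N (r *\<^sub>R v) = \<bar>r\<bar> * N v) \<and>
     (\<forall>u v. N (u + v) \<le> N u + N v)"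

definition real_vec :: "int ^ 'm \<Rightarrow> real ^ 'm" where
  "real_vec n = (\<chi> i. real_of_int (n $ i))"

definition coeff_gcd :: "nat \<Rightarrow> (nat \<Rightarrow> 'm::finite zpoly) \<Rightarrow> int ^ 'm \<Rightarrow> int" where
  "coeff_gcd d c n = Gcd ((\<lambda>i. zeval (c i) n) ` {0..d})"

definition nu :: "'m::finite zpoly poly \<Rightarrow> nat \<Rightarrow> int ^ 'm \<Rightarrow> nat" where
  "nu f p n = card {x \<in> {0..<int p}. poly (specialise f n) x mod int p = 0}"

definition root_sum :: "'m::finite zpoly poly \<Rightarrow> (int ^ 'm \<Rightarrow> real) \<Rightarrow> (int ^ 'm) set \<Rightarrow> real" where
  "root_sum f w A = (\<Sum>\<^sub>\<infinity>n\<in>{n \<in> A. \<exists>x::int. poly (specialise f n) x = 0}. w n)"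

definition sieve_sum ::
    "'m::finite zpoly poly \<Rightarrow> (int ^ 'm \<Rightarrow> int) \<Rightarrow> 'm zpoly \<Rightarrow> (int ^ 'm \<Rightarrow> real) \<Rightarrow> (int ^ 'm) set \<Rightarrow>
     nat \<Rightarrow> nat \<Rightarrow> nat \<Rightarrow> nat \<Rightarrow> real" where
  "sieve_sum f h g w A i j p q =
     (\<Sum>\<^sub>\<infinity>n\<in>{n \<in> A. gcd (int (p * q)) (zeval g n * h n) = 1}.
        w n * real (nu f p n) ^ i * real (nu f q n) ^ j)"

definition sieve_coeff :: "real \<Rightarrow> real \<Rightarrow> nat \<Rightarrow> nat \<Rightarrow> real" where
  "sieve_coeff d a i j =
     (if (i, j) = (0, 0) then (a - d)\<^sup>2
      else if (i, j) \<in> {(1, 0), (0, 1)} then a + (a - 1) * d - d\<^sup>2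
      else if (i, j) = (1, 1) then (1 + d)\<^sup>2
      else if (i, j) \<in> {(2, 0), (0, 2)} then - a + d
      else if (i, j) \<in> {(2, 1), (1, 2)} then - 1 - d
      else if (i, j) = (2, 2) then 1
      else 0)"

end

theory Submission
  imports Defs
begin

text \<open>
  Put \<open>t\<^sub>p(n) = \<alpha> + (\<nu>\<^sub>p(n) - 1)(d - \<nu>\<^sub>p(n))\<close> if \<open>p\<close> does not divide \<open>g(n)h(n)\<close>, and \<open>t\<^sub>p(n) = 0\<close>
  otherwise. The coefficients \<open>c\<^sub>i\<^sub>j(\<alpha>)\<close> are those of the product \<open>t\<^sub>p(n)t\<^sub>q(n)\<close> as a polynomial
  in \<open>\<nu>\<^sub>p(n)\<close> and \<open>\<nu>\<^sub>q(n)\<close>, so the double sum over \<open>p, q\<close> is at least the sum of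
  \<open>w(n)(\<Sum>\<^sub>p t\<^sub>p(n))\<^sup>2\<close> over \<open>n \<in> A\<close>. If \<open>f(x;n)\<close> has an integer root, then \<open>1 \<le> \<nu>\<^sub>p(n) \<le> d\<close>, hence
  \<open>t\<^sub>p(n) \<ge> \<alpha> \<ge> 1\<close>, for every \<open>p\<close> not dividing \<open>g(n)h(n)\<close>. On the support of \<open>w\<close> the non-zero
  integer \<open>g(n)h(n)\<close> is at most \<open>exp(O(P))\<close>, so at most \<open>P/2\<close> of the primes divide it once \<open>P\<close> is
  large, and the square is at least \<open>P\<^sup>2/4\<close>.
\<close>

section \<open>Roots of an integer polynomial modulo a prime\<close>

text \<open>Lagrange's theorem, by splitting off one root at a time; the induction runs on the bound
  \<open>d\<close>, since the degree modulo \<open>p\<close> may be smaller than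
  \<open>degree P\<close>.\<close>

lemma card_roots_mod_prime_le:
  fixes P :: "int poly" and p :: nat
  assumes "prime p" "\<not> (\<forall>k. int p dvd coeff P k)" "degree P \<le> d"
  shows "card {x \<in> {0..<int p}. int p dvd poly P x} \<le> d"
  using assms(2,3)
proof (induction d arbitrary: P)
  case 0
  then obtain a where P: "P = [:a:]"
    by (metis degree_eq_zeroE le_zero_eq)
  then have "int p dvd coeff P k" if "int p dvd a" for k
    using that by (cases k) auto
  then have "\<not> int p dvd a" using 0 by blast
  then have "{x \<in> {0..<int p}. int p dvd poly P x} = {}"
    using P by simp
  then show ?case by (metis card.empty le_refl)
next
  case (Suc d)
  let ?R = "\<lambda>P. {x \<in> {0..<int p}. int p dvd poly P x}"
  show ?case
  proof (cases "?R P = {}")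
    case False
    then obtain a where a: "a \<in> {0..<int p}" "int p dvd poly P a" by auto
    define Q where "Q = synthetic_div P a"
    \<comment> \<open>The remainder \<open>poly P a\<close> need not vanish, but \<open>p\<close>
      divides it, so this is a factorisation modulo \<open>p\<close>. For the same reason
      \<open>Q\<close> inherits a coefficient not divisible by \<open>p\<close>.\<close>
    have PQ: "P = [:poly P a:] + [:- a, 1:] * Q"
      unfolding Q_def using synthetic_div_correct'[of a P] by (simp add: add.commute)
    have "degree Q \<le> d"
      using Suc.prems(2) by (simp add: Q_def degree_synthetic_div)
    moreover have "\<not> (\<forall>k. int p dvd coeff Q k)"
    proof
      assume "\<forall>k. int p dvd coeff Q k"
      then have "[:int p:] dvd Q" by (simp add: const_poly_dvd_iff)
      moreover have "[:int p:] dvd [:poly P a:]" using a(2) by simp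
      ultimately have "[:int p:] dvd P"
        by (subst PQ) (intro dvd_add dvd_mult)
      then show False using Suc.prems(1) by (simp add: const_poly_dvd_iff)
    qed
    ultimately have IH: "card (?R Q) \<le> d" using Suc.IH by blast
    have "?R P \<subseteq> insert a (?R Q)"
    proof
      fix b assume b: "b \<in> ?R P"
      have "poly P b = poly P a + (b - a) * poly Q b"
        by (subst PQ) (simp add: algebra_simps)
      then have "int p dvd (b - a) * poly Q b"
        using a(2) b by (metis (no_types, lifting) dvd_add_right_iff mem_Collect_eq)
      then have "int p dvd b - a \<or> int p dvd poly Q b"
        using assms(1) by (simp add: prime_dvd_mult_iff)
      moreover have "b = a" if "int p dvd b - a"
        using that a(1) b by (auto simp: mod_eq_dvd_iff[symmetric])
      ultimately show "b \<in> insert a (?R Q)" using b by auto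
    qed
    moreover have "finite (?R Q)" by (rule finite_subset[of _ "{0..<int p}"]) auto
    ultimately have "card (?R P) \<le> card (insert a (?R Q))"
      by (intro card_mono) simp_all
    also have "\<dots> \<le> Suc (card (?R Q))" using \<open>finite (?R Q)\<close> by (simp add: card_insert_if)
    finally show ?thesis using IH by linarith
  qed (metis card.empty zero_le)
qed

section \<open>Prime divisors of an integer of bounded size\<close>

lemma prod_primes_dvd:
  fixes m :: nat
  assumes "finite R" "\<And>p. p \<in> R \<Longrightarrow> prime p" "\<And>p. p \<in> R \<Longrightarrow> p dvd m"
  shows "\<Prod>R dvd m"
  using assms
proof (induction R)
  case (insert p R)
  then have "coprime p (\<Prod>R)"
    by (intro prod_coprime_right) (metis insertCI primes_coprime)
  then show ?case using insert by (simp add: divides_mult)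
qed simp

text \<open>Fewer than \<open>B + 1\<close> primes lie below \<open>B\<close>. The remaining ones
  are each at least \<open>B\<close>, and their product divides \<open>M\<close>.\<close>

lemma power_card_prime_divisors_le:
  fixes M :: int and B :: nat
  assumes "M \<noteq> 0" "finite Q" "\<And>p. p \<in> Q \<Longrightarrow> prime p \<and> int p dvd M" "B > 0"
  shows "B ^ (card Q - B) \<le> nat \<bar>M\<bar>"
proof -
  define R where "R = Q - {..<B}"
  have R: "finite R" "\<And>p. p \<in> R \<Longrightarrow> prime p" "\<And>p. p \<in> R \<Longrightarrow> p dvd nat \<bar>M\<bar>"
    using assms by (auto simp: R_def int_dvd_int_iff[symmetric])
  have "card Q - B \<le> card R"
    using diff_card_le_card_Diff[of "{..<B}" Q] by (simp add: R_def)
  then have "B ^ (card Q - B) \<le> B ^ card R"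
    using assms(4) by (intro power_increasing) auto
  also have "\<dots> = (\<Prod>p\<in>R. B)" by simp
  also have "\<dots> \<le> \<Prod>R" by (intro prod_mono) (auto simp: R_def)
  also have "\<Prod>R \<le> nat \<bar>M\<bar>"
    using prod_primes_dvd[OF R] assms(1) by (intro dvd_imp_le) auto
  finally show ?thesis .
qed

lemma few_prime_divisors:
  fixes K :: real
  assumes "K > 0"
  obtains P0 :: nat where "\<And>(T::nat) (M::int) Q. T \<ge> P0 \<Longrightarrow> M \<noteq> 0 \<Longrightarrow> \<bar>real_of_int M\<bar> \<le> exp (K * T) \<Longrightarrow>
    finite Q \<Longrightarrow> (\<And>p. p \<in> Q \<Longrightarrow> prime p \<and> int p dvd M) \<Longrightarrow> 2 * card Q \<le> T"
proof -
  \<comment> \<open>If more than \<open>T/2\<close> primes divided \<open>M\<close>, then \<open>B ^ (T/2 - B) \<le> exp (K T)\<close>, whence \<open>T < 4 B\<close>.\<close>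
  define B where "B = nat \<lceil>exp (4 * K)\<rceil>"
  have B: "real B \<ge> exp (4 * K)" unfolding B_def by linarith
  then have B0: "B > 0" by (metis exp_gt_zero less_le_trans of_nat_0_less_iff)
  show thesis
  proof (rule that[of "4 * B"])
    fix T :: nat and M :: int and Q :: "nat set"
    assume T: "T \<ge> 4 * B" and M: "M \<noteq> 0" "\<bar>real_of_int M\<bar> \<le> exp (K * T)"
      and Q: "finite Q" "\<And>p. p \<in> Q \<Longrightarrow> prime p \<and> int p dvd M"
    show "2 * card Q \<le> T"
    proof (rule ccontr)
      assume *: "\<not> 2 * card Q \<le> T"
      have "exp (4 * K * real (card Q - B)) = exp (4 * K) ^ (card Q - B)"
        by (simp add: exp_of_nat_mult[symmetric] mult.commute)
      also have "\<dots> \<le> real B ^ (card Q - B)" using B by (intro power_mono) auto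
      also have "\<dots> = real (B ^ (card Q - B))" by simp
      also have "\<dots> \<le> real (nat \<bar>M\<bar>)"
        using power_card_prime_divisors_le[OF M(1) Q B0] by (simp only: of_nat_le_iff)
      also have "\<dots> \<le> exp (K * T)" using M(2) by simp
      finally have "K * (4 * real (card Q - B)) \<le> K * T" by (simp add: mult_ac)
      then have "4 * real (card Q - B) \<le> T" using assms by simp
      \<comment> \<open>The base \<open>exp (4 * K)\<close> was chosen to give
        \<open>card Q - B\<close> \<le> \<open>T / 4\<close>; with \<open>B\<close> \<le>
        \<open>T / 4\<close> this contradicts \<open>card Q > T / 2\<close>.\<close>
      then show False using * T by linarith
    qed
  qed
qed

section \<open>Growth of polynomial values and comparison of norms\<close>

lemma zeval_bound:
  fixes p :: "'m::finite zpoly"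
  obtains K D where "K \<ge> 0" "\<And>n R. R \<ge> 1 \<Longrightarrow> (\<And>i. \<bar>real_of_int (n $ i)\<bar> \<le> R) \<Longrightarrow>
    \<bar>real_of_int (zeval p n)\<bar> \<le> K * R ^ D"
proof -
  define e :: "('m \<Rightarrow>\<^sub>0 nat) \<Rightarrow> nat" where "e = (\<lambda>k. \<Sum>i\<in>UNIV. Poly_Mapping.lookup k i)"
  \<comment> \<open>Any common bound for the total degrees of the monomials serves; a sum, unlike a
    maximum, needs no separate case for the zero polynomial.\<close>
  define D where "D = (\<Sum>k\<in>Poly_Mapping.keys p. e k)"
  define K where "K = (\<Sum>k\<in>Poly_Mapping.keys p. \<bar>real_of_int (Poly_Mapping.lookup p k)\<bar>)"
  show thesis
  proof (rule that[of K D])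
    show "K \<ge> 0" by (simp add: K_def sum_nonneg)
    fix n :: "int ^ 'm" and R :: real
    assume R: "R \<ge> 1" "\<And>i. \<bar>real_of_int (n $ i)\<bar> \<le> R"
    have "\<bar>real_of_int (zeval p n)\<bar> \<le> (\<Sum>k\<in>Poly_Mapping.keys p. \<bar>real_of_int (Poly_Mapping.lookup p k)\<bar> *
       (\<Prod>i\<in>UNIV. \<bar>real_of_int (n $ i)\<bar> ^ Poly_Mapping.lookup k i))"
      unfolding zeval_def of_int_sum
      by (rule order_trans[OF sum_abs]) (simp add: abs_mult abs_prod power_abs)
    also have "\<dots> \<le> (\<Sum>k\<in>Poly_Mapping.keys p. \<bar>real_of_int (Poly_Mapping.lookup p k)\<bar> * R ^ D)"
    proof (intro sum_mono mult_left_mono)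
      fix k assume k: "k \<in> Poly_Mapping.keys p"
      have "(\<Prod>i\<in>UNIV. \<bar>real_of_int (n $ i)\<bar> ^ Poly_Mapping.lookup k i) \<le> (\<Prod>i\<in>UNIV. R ^ Poly_Mapping.lookup k i)"
        using R by (intro prod_mono) (auto intro: power_mono)
      also have "\<dots> = R ^ e k" by (simp add: e_def power_sum)
      also have "\<dots> \<le> R ^ D"
        using R(1) k unfolding D_def by (intro power_increasing member_le_sum) auto
      finally show "(\<Prod>i\<in>UNIV. \<bar>real_of_int (n $ i)\<bar> ^ Poly_Mapping.lookup k i) \<le> R ^ D" .
    qed auto
    also have "\<dots> = K * R ^ D" by (simp add: K_def sum_distrib_right)
    finally show "\<bar>real_of_int (zeval p n)\<bar> \<le> K * R ^ D" .
  qed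
qed

text \<open>One half of the equivalence of norms in finite dimension: \<open>N\<close> is Lipschitz,
  so it attains a positive minimum on the compact unit sphere, and homogeneity extends the bound to
  all vectors.\<close>

lemma is_norm_dominates_norm:
  fixes N :: "'a::euclidean_space \<Rightarrow> real"
  assumes "is_norm N"
  obtains L where "L > 0" "\<And>v. norm v \<le> L * N v"
proof -
  have N0: "N v = 0 \<longleftrightarrow> v = 0" and Ns: "N (r *\<^sub>R v) = \<bar>r\<bar> * N v" and Nt: "N (u + v) \<le> N u + N v" for r u v
    using assms by (auto simp: is_norm_def)
  have Nneg: "N (- v) = N v" for v using Ns[of "-1" v] by simp
  \<comment> \<open>Nonnegativity is not an axiom of \<open>is_norm\<close>; it follows from 0 =
    \<open>N (v - v)\<close> \<le> \<open>2 * N v\<close>.\<close>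
  have Npos: "N v \<ge> 0" for v using Nt[of v "- v"] N0[of 0] Nneg[of v] by simp
  define K where "K = (\<Sum>b\<in>(Basis::'a set). N b)"
  have Nsum: "N (sum f S) \<le> (\<Sum>b\<in>S. N (f b))" if "finite S" for f :: "'a \<Rightarrow> 'a" and S
    using that
  proof induction
    case empty
    then show ?case using N0[of 0] by simp
  next
    case (insert x F)
    then show ?case using Nt[of "f x" "sum f F"] by simp
  qed
  have NK: "N v \<le> K * norm v" for v
  proof -
    have "N v = N (\<Sum>b\<in>Basis. (v \<bullet> b) *\<^sub>R b)" by (simp add: euclidean_representation)
    also have "\<dots> \<le> (\<Sum>b\<in>Basis. \<bar>v \<bullet> b\<bar> * N b)"
      using Nsum[of Basis "\<lambda>b. (v \<bullet> b) *\<^sub>R b"] by (simp add: Ns)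
    also have "\<dots> \<le> (\<Sum>b\<in>Basis. norm v * N b)"
      by (intro sum_mono mult_right_mono Npos Basis_le_norm) auto
    finally show ?thesis by (simp add: K_def sum_distrib_left mult.commute)
  qed
  have lip: "\<bar>N u - N v\<bar> \<le> K * dist u v" for u v
    using Nt[of "u - v" v] Nt[of "v - u" u] NK[of "u - v"] NK[of "v - u"]
    by (simp add: dist_norm norm_minus_commute)
  have K0: "K \<ge> 0" unfolding K_def by (intro sum_nonneg Npos)
  have "K-lipschitz_on (sphere 0 1) N"
    using lip K0 by (auto simp: lipschitz_on_def dist_real_def)
  then have "continuous_on (sphere 0 1) N" by (rule lipschitz_on_continuous_on)
  then obtain x where x: "x \<in> sphere 0 1" "\<And>y. y \<in> sphere 0 1 \<Longrightarrow> N x \<le> N y"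
    using continuous_attains_inf[of "sphere 0 1" N] by (auto simp: sphere_eq_empty)
  have Nx: "N x > 0" using x(1) N0[of x] Npos[of x] by force
  show thesis
  proof (rule that[of "1 / N x"])
    show "1 / N x > 0" using Nx by simp
    fix v
    show "norm v \<le> 1 / N x * N v"
    proof (cases "v = 0")
      case True
      then show ?thesis using N0[of 0] by simp
    next
      case False
      then have "N x \<le> N ((1 / norm v) *\<^sub>R v)" by (intro x(2)) simp
      then show ?thesis using Nx False by (simp add: Ns field_simps)
    qed
  qed
qed

section \<open>Finite sums of convergent series\<close>

lemma has_sum_sum:
  fixes F :: "'i \<Rightarrow> 'a \<Rightarrow> 'b::topological_comm_monoid_add"
  assumes "finite I" "\<And>i. i \<in> I \<Longrightarrow> (F i has_sum s i) A"
  shows "((\<lambda>x. \<Sum>i\<in>I. F i x) has_sum (\<Sum>i\<in>I. s i)) A"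
  using assms by (induction I) (auto intro: has_sum_add)

section \<open>The specialised polynomial and its number of roots modulo p\<close>

lemma coeff_specialise: "coeff (specialise f n) k = zeval (coeff f k) n"
  unfolding specialise_def by (rule coeff_map_poly) (simp add: zeval_def)

context
  fixes f :: "'m::finite zpoly poly" and c :: "nat \<Rightarrow> 'm zpoly" and d :: nat
  assumes f: "f = (\<Sum>i\<le>d. monom (c i) (d - i))"
begin

lemma coeff_f: "coeff f k = (if k \<le> d then c (d - k) else 0)"
proof -
  have "coeff f k = (\<Sum>i\<le>d. if d - i = k then c i else 0)"
    by (simp add: f coeff_sum)
  also have "\<dots> = (\<Sum>i\<le>d. if k \<le> d \<and> i = d - k then c i else 0)"
    by (intro sum.cong) auto
  finally show ?thesis by (cases "k \<le> d") auto
qed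

lemma degree_specialise_le: "degree (specialise f n) \<le> d"
  by (rule degree_le) (simp add: coeff_specialise coeff_f zeval_def)

text \<open>If \<open>p\<close> divided every coefficient of the specialised polynomial, it would
  divide their gcd; so Lagrange's bound applies.\<close>

lemma nu_le:
  assumes "prime p" "coprime (int p) (coeff_gcd d c n)"
  shows "nu f p n \<le> d"
proof -
  have "\<not> (\<forall>k. int p dvd coeff (specialise f n) k)"
  proof
    assume *: "\<forall>k. int p dvd coeff (specialise f n) k"
    have "int p dvd zeval (c i) n" if "i \<le> d" for i
      using *[rule_format, of "d - i"] that by (simp add: coeff_specialise coeff_f)
    then have "int p dvd coeff_gcd d c n"
      by (auto simp: coeff_gcd_def intro: Gcd_greatest)
    then show False
      using assms by (metis coprime_absorb_left not_prime_unit prime_nat_int_transfer)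
  qed
  then show ?thesis
    using card_roots_mod_prime_le[OF assms(1) _ degree_specialise_le]
    by (simp add: nu_def dvd_eq_mod_eq_0)
qed

lemma nu_ge_1:
  assumes "prime p" "poly (specialise f n) x = 0"
  shows "1 \<le> nu f p n"
proof -
  let ?F = "specialise f n"
  have p: "0 < int p" using assms(1) prime_gt_0_nat by simp
  obtain Q where Q: "?F = [:- x, 1:] * Q" using assms(2) by (auto simp: poly_eq_0_iff_dvd)
  have "poly ?F (x mod int p) = (x mod int p - x) * poly Q (x mod int p)"
    unfolding Q by (simp add: algebra_simps)
  moreover have "int p dvd x mod int p - x"
    by (metis dvd_minus_iff dvd_minus_mod minus_diff_eq)
  ultimately have "int p dvd poly ?F (x mod int p)"
    by simp
  then have "x mod int p \<in> {x \<in> {0..<int p}. poly ?F x mod int p = 0}"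
    using p unfolding mod_eq_0_iff_dvd by simp
  moreover have "finite {x \<in> {0..<int p}. poly ?F x mod int p = 0}"
    by (rule finite_subset[of _ "{0..<int p}"]) auto
  ultimately show ?thesis
    unfolding nu_def One_nat_def Suc_le_eq card_gt_0_iff by (metis empty_iff)
qed

text \<open>A crude bound, free of any coprimality condition and uniform in \<open>n\<close>; it
  serves to dominate the series in \<open>has_sum_sieve_sum\<close>.\<close>

lemma nu_le_prime: "nu f p n \<le> p"
proof -
  have "nu f p n \<le> card {0..<int p}" unfolding nu_def by (intro card_mono) auto
  then show ?thesis by simp
qed

section \<open>The size of g(n)h(n)\<close>

text \<open>A nonzero gcd divides some nonzero coefficient value. Which one depends on
  \<open>n\<close>, so the sum over all of them gives a uniform bound.\<close>

lemma abs_coeff_gcd_le: "\<bar>coeff_gcd d c n\<bar> \<le> (\<Sum>i\<le>d. \<bar>zeval (c i) n\<bar>)"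
proof (cases "coeff_gcd d c n = 0")
  case False
  then have "\<not> (\<forall>i\<le>d. zeval (c i) n = 0)"
    by (auto simp: coeff_gcd_def)
  then obtain i where i: "i \<le> d" "zeval (c i) n \<noteq> 0"
    by blast
  then have "coeff_gcd d c n dvd zeval (c i) n" by (auto simp: coeff_gcd_def)
  then have "\<bar>coeff_gcd d c n\<bar> \<le> \<bar>zeval (c i) n\<bar>" using i(2) by (rule dvd_imp_le_int[rotated])
  also have "\<dots> \<le> (\<Sum>i\<le>d. \<bar>zeval (c i) n\<bar>)" using i(1) by (intro member_le_sum) auto
  finally show ?thesis .
qed (simp add: sum_nonneg)

lemma coeff_gcd_bound:
  obtains K D where "K \<ge> 0" "\<And>n R. R \<ge> 1 \<Longrightarrow> (\<And>i. \<bar>real_of_int (n $ i)\<bar> \<le> R) \<Longrightarrow>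
    \<bar>real_of_int (coeff_gcd d c n)\<bar> \<le> K * R ^ D"
proof -
  have "\<forall>j. \<exists>K D. K \<ge> 0 \<and> (\<forall>n R. R \<ge> 1 \<longrightarrow> (\<forall>i. \<bar>real_of_int (n $ i)\<bar> \<le> R) \<longrightarrow>
    \<bar>real_of_int (zeval (c j) n)\<bar> \<le> K * R ^ D)"
    by (metis zeval_bound)
  then obtain K D where KD: "\<And>j. K j \<ge> 0" "\<And>j n R. R \<ge> 1 \<Longrightarrow> (\<forall>i. \<bar>real_of_int (n $ i)\<bar> \<le> R) \<Longrightarrow>
    \<bar>real_of_int (zeval (c j) n)\<bar> \<le> K j * R ^ D j"
    by metis
  show thesis
  proof (rule that[of "\<Sum>j\<le>d. K j" "\<Sum>j\<le>d. D j"])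
    show "(\<Sum>j\<le>d. K j) \<ge> 0" using KD(1) by (simp add: sum_nonneg)
    fix n :: "int ^ 'm" and R :: real
    assume R: "R \<ge> 1" "\<And>i. \<bar>real_of_int (n $ i)\<bar> \<le> R"
    have "\<bar>real_of_int (coeff_gcd d c n)\<bar> \<le> (\<Sum>j\<le>d. \<bar>real_of_int (zeval (c j) n)\<bar>)"
      using abs_coeff_gcd_le[of n, folded of_int_le_iff[where 'a = real]] by simp
    also have "\<dots> \<le> (\<Sum>j\<le>d. K j * R ^ (\<Sum>j\<le>d. D j))"
    proof (intro sum_mono)
      fix j assume j: "j \<in> {..d}"
      have "\<bar>real_of_int (zeval (c j) n)\<bar> \<le> K j * R ^ D j" using KD(2) R by blast
      also have "\<dots> \<le> K j * R ^ (\<Sum>j\<le>d. D j)"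
        using R(1) j KD(1) by (intro mult_left_mono power_increasing member_le_sum) auto
      finally show "\<bar>real_of_int (zeval (c j) n)\<bar> \<le> K j * R ^ (\<Sum>j\<le>d. D j)" .
    qed
    also have "\<dots> = (\<Sum>j\<le>d. K j) * R ^ (\<Sum>j\<le>d. D j)" by (simp add: sum_distrib_right)
    finally show "\<bar>real_of_int (coeff_gcd d c n)\<bar> \<le> (\<Sum>j\<le>d. K j) * R ^ (\<Sum>j\<le>d. D j)" .
  qed
qed

text \<open>Polynomial growth at points whose coordinates are O(\<open>exp T\<close>); the condition
  \<open>T\<close> \<ge> 1 lets the multiplicative constant be absorbed into the exponent.\<close>

lemma modulus_bound:
  fixes N :: "real ^ 'm \<Rightarrow> real" and g :: "'m zpoly"
  assumes "is_norm N"
  obtains K where "K > 0" "\<And>n T. T \<ge> 1 \<Longrightarrow> N (real_vec n) < exp T \<Longrightarrow>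
    \<bar>real_of_int (zeval g n * coeff_gcd d c n)\<bar> \<le> exp (K * T)"
proof -
  obtain L where L: "L > 0" "\<And>v. norm v \<le> L * N v" using is_norm_dominates_norm[OF assms] by blast
  obtain K1 D1 where 1: "K1 \<ge> 0" "\<And>n R. R \<ge> 1 \<Longrightarrow> (\<And>i. \<bar>real_of_int (n $ i)\<bar> \<le> R) \<Longrightarrow>
    \<bar>real_of_int (zeval g n)\<bar> \<le> K1 * R ^ D1" using zeval_bound by blast
  obtain K2 D2 where 2: "K2 \<ge> 0" "\<And>n R. R \<ge> 1 \<Longrightarrow> (\<And>i. \<bar>real_of_int (n $ i)\<bar> \<le> R) \<Longrightarrow>
    \<bar>real_of_int (coeff_gcd d c n)\<bar> \<le> K2 * R ^ D2" using coeff_gcd_bound by blast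
  define E where "E = K1 * K2 * (L + 1) ^ (D1 + D2)"
  have E: "E \<ge> 0" using 1(1) 2(1) L(1) by (simp add: E_def)
  show thesis
  \<comment> \<open>The summand 1 only secures strict positivity, which
    \<open>few_prime_divisors\<close> asks of its constant.\<close>
  proof (rule that[of "E + (D1 + D2) + 1"])
    show "E + (D1 + D2) + 1 > 0" using E by simp
    fix n :: "int ^ 'm" and T :: real
    assume T: "T \<ge> 1" "N (real_vec n) < exp T"
    \<comment> \<open>The factor \<open>L + 1\<close> instead of \<open>L\<close> ensures
      \<open>R\<close> \<ge> 1.\<close>
    define R where "R = (L + 1) * exp T"
    have "1 * 1 \<le> (L + 1) * exp T" using L(1) T(1) by (intro mult_mono) auto
    then have R1: "R \<ge> 1" by (simp add: R_def)
    have nR: "\<bar>real_of_int (n $ i)\<bar> \<le> R" for i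
    proof -
      have "\<bar>real_of_int (n $ i)\<bar> \<le> norm (real_vec n)"
        using component_le_norm_cart[of "real_vec n" i] by (simp add: real_vec_def)
      also have "\<dots> \<le> L * N (real_vec n)" by (rule L)
      also have "\<dots> \<le> L * exp T" using L(1) T(2) by (intro mult_left_mono) auto
      also have "\<dots> \<le> R" by (simp add: R_def algebra_simps)
      finally show ?thesis .
    qed
    have "\<bar>real_of_int (zeval g n * coeff_gcd d c n)\<bar> \<le> (K1 * R ^ D1) * (K2 * R ^ D2)"
      using 1 2 R1 nR by (simp only: of_int_mult abs_mult) (intro mult_mono, auto)
    also have "\<dots> = E * exp T ^ (D1 + D2)"
      by (simp add: E_def R_def power_mult_distrib power_add mult_ac)
    also have "\<dots> \<le> exp (E * T) * exp T ^ (D1 + D2)"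
    proof (intro mult_right_mono)
      have "E * 1 \<le> E * T" using E T(1) by (intro mult_left_mono)
      also have "\<dots> \<le> exp (E * T)" using exp_ge_add_one_self[of "E * T"] by linarith
      finally show "E \<le> exp (E * T)" by simp
    qed simp
    also have "\<dots> = exp ((E + (D1 + D2)) * T)"
      by (simp add: exp_of_nat_mult[symmetric] exp_add[symmetric] algebra_simps)
    also have "\<dots> \<le> exp ((E + (D1 + D2) + 1) * T)" using T(1) by (simp add: algebra_simps)
    finally show "\<bar>real_of_int (zeval g n * coeff_gcd d c n)\<bar> \<le> exp ((E + (D1 + D2) + 1) * T)" .
  qed
qed

section \<open>The weights attached to the primes\<close>

text \<open>This is \<open>t\<^sub>p(n)\<close>. Coprimality in place of non-divisibility matches
  the gcd condition in \<open>sieve_sum\<close>, so the expansion below holds for arbitrary natural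
  numbers \<open>p\<close> and \<open>q\<close>.\<close>

definition sieve_weight :: "'m zpoly \<Rightarrow> nat \<Rightarrow> nat \<Rightarrow> int ^ 'm \<Rightarrow> real" where
  "sieve_weight g \<alpha> p n = (if coprime (int p) (zeval g n * coeff_gcd d c n)
     then \<alpha> + (real (nu f p n) - 1) * (d - real (nu f p n)) else 0)"

lemma sieve_weight_ge:
  assumes "prime p" "coprime (int p) (zeval g n * coeff_gcd d c n)" "poly (specialise f n) x = 0"
  shows "\<alpha> \<le> sieve_weight g \<alpha> p n"
proof -
  have "nu f p n \<le> d" using assms(1,2) by (intro nu_le) (auto simp: coprime_mult_right_iff)
  moreover have "1 \<le> nu f p n" using assms(1,3) by (rule nu_ge_1)
  ultimately show ?thesis using assms(2) by (simp add: sieve_weight_def)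
qed

text \<open>The root is essential: in the coprime case with \<open>nu f p n = 0\<close> the weight
  is \<alpha> - \<open>d\<close>, possibly negative. Hence the sum of the weights is squared
  later.\<close>

lemma sieve_weight_nonneg:
  assumes "prime p" "poly (specialise f n) x = 0"
  shows "0 \<le> sieve_weight g \<alpha> p n"
proof (cases "coprime (int p) (zeval g n * coeff_gcd d c n)")
  case True
  then show ?thesis using sieve_weight_ge[OF assms(1) True assms(2), of \<alpha>] by linarith
qed (simp only: sieve_weight_def if_False order_refl)

lemma sum_sieve_weight_ge:
  assumes "finite \<P>" "\<And>p. p \<in> \<P> \<Longrightarrow> prime p" "poly (specialise f n) x = 0" "\<alpha> > 0"
    "2 * card {p \<in> \<P>. int p dvd zeval g n * coeff_gcd d c n} \<le> card \<P>"
  shows "card \<P> / 2 \<le> (\<Sum>p\<in>\<P>. sieve_weight g \<alpha> p n)"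
proof -
  define M where "M = zeval g n * coeff_gcd d c n"
  have "real (card \<P>) / 2 \<le> card \<P> - card {p \<in> \<P>. int p dvd M}"
    using assms(5) unfolding M_def by linarith
  also have "\<dots> = card (\<P> - {p \<in> \<P>. int p dvd M})"
    using assms(1) by (subst card_Diff_subset) auto
  also have "\<dots> = (\<Sum>p\<in>\<P> - {p \<in> \<P>. int p dvd M}. 1)" by simp
  also have "\<dots> \<le> (\<Sum>p\<in>\<P> - {p \<in> \<P>. int p dvd M}. sieve_weight g \<alpha> p n)"
  proof (rule sum_mono)
    fix p assume p: "p \<in> \<P> - {p \<in> \<P>. int p dvd M}"
    then have "coprime (int p) M" using assms(2) by (auto intro!: prime_imp_coprime)
    then have "\<alpha> \<le> sieve_weight g \<alpha> p n"
      using p assms(2,3) by (intro sieve_weight_ge) (auto simp: M_def)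
    then show "1 \<le> sieve_weight g \<alpha> p n" using assms(4) by linarith
  qed
  also have "\<dots> \<le> (\<Sum>p\<in>\<P>. sieve_weight g \<alpha> p n)"
    using assms(1-3) by (intro sum_mono2) (auto intro: sieve_weight_nonneg)
  finally show ?thesis .
qed

section \<open>Expanding the square into sieve sums\<close>

text \<open>Writing the gcd condition as a product of two indicators puts all nine sums on the
  common index set \<open>A\<close> and separates \<open>p\<close> from \<open>q\<close>.
  Convergence follows by comparison with a multiple of \<open>w\<close>.\<close>

lemma has_sum_sieve_sum:
  assumes "\<And>n. w n \<ge> 0" "w summable_on UNIV"
  shows "((\<lambda>n. (if coprime (int p) (zeval g n * coeff_gcd d c n) then 1 else 0) *
      (if coprime (int q) (zeval g n * coeff_gcd d c n) then 1 else 0) *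
      (w n * real (nu f p n) ^ i * real (nu f q n) ^ j))
    has_sum sieve_sum f (coeff_gcd d c) g w A i j p q) A"
    (is "(?F has_sum _) A")
proof -
  have "?F summable_on A"
  proof (rule summable_on_comparison_test)
    have "w summable_on A" using assms(2) by (rule summable_on_subset) simp
    then show "(\<lambda>n. (real p ^ i * real q ^ j) * w n) summable_on A"
      by (rule summable_on_cmult_right)
    fix n
    have "real (nu f p n) ^ i * real (nu f q n) ^ j \<le> real p ^ i * real q ^ j"
      by (intro mult_mono power_mono) (auto simp: nu_le_prime)
    then have "w n * (real (nu f p n) ^ i * real (nu f q n) ^ j) \<le> w n * (real p ^ i * real q ^ j)"
      using assms(1) by (intro mult_left_mono)
    then show "?F n \<le> (real p ^ i * real q ^ j) * w n"
      using assms(1)[of n] by (auto simp: mult_ac)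
    show "0 \<le> ?F n" using assms(1)[of n] by auto
  qed
  moreover have "infsum ?F A = sieve_sum f (coeff_gcd d c) g w A i j p q"
    unfolding sieve_sum_def
    by (rule infsum_cong_neutral)
      (auto simp flip: coprime_iff_gcd_eq_1 simp: coprime_mult_left_iff)
  ultimately show ?thesis by (simp add: has_sum_iff)
qed

lemma has_sum_sieve_weight:
  assumes "\<And>n. w n \<ge> 0" "w summable_on UNIV"
  shows "((\<lambda>n. w n * (sieve_weight g \<alpha> p n * sieve_weight g \<alpha> q n)) has_sum
    (\<Sum>i\<in>{0,1,2}. \<Sum>j\<in>{0,1,2}. sieve_coeff (real d) (real \<alpha>) i j *
        sieve_sum f (coeff_gcd d c) g w A i j p q)) A"
proof -
  have "((\<lambda>n. \<Sum>i\<in>{0,1,2}. \<Sum>j\<in>{0,1,2}. sieve_coeff (real d) (real \<alpha>) i j *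
      ((if coprime (int p) (zeval g n * coeff_gcd d c n) then 1 else 0) *
      (if coprime (int q) (zeval g n * coeff_gcd d c n) then 1 else 0) *
      (w n * real (nu f p n) ^ i * real (nu f q n) ^ j))) has_sum
    (\<Sum>i\<in>{0,1,2}. \<Sum>j\<in>{0,1,2}. sieve_coeff (real d) (real \<alpha>) i j *
        sieve_sum f (coeff_gcd d c) g w A i j p q)) A"
    by (intro has_sum_sum has_sum_cmult_right has_sum_sieve_sum assms) auto
  also have "(\<lambda>n. \<Sum>i\<in>{0,1,2}. \<Sum>j\<in>{0,1,2}. sieve_coeff (real d) (real \<alpha>) i j *
      ((if coprime (int p) (zeval g n * coeff_gcd d c n) then 1 else 0) *
      (if coprime (int q) (zeval g n * coeff_gcd d c n) then 1 else 0) *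
      (w n * real (nu f p n) ^ i * real (nu f q n) ^ j))) =
    (\<lambda>n. w n * (sieve_weight g \<alpha> p n * sieve_weight g \<alpha> q n))"
    \<comment> \<open>When both indicators are 1, this is the expansion of the product of \<alpha> -
      \<open>d\<close> + \<open>(1 + d) * x\<close> - \<open>x * x\<close> and the same polynomial
      in \<open>y\<close>, at \<open>x = nu f p n\<close> and \<open>y = nu f q n\<close>; otherwise
      both sides vanish.\<close>
    by (rule ext)
      (auto simp: sieve_weight_def sieve_coeff_def algebra_simps power2_eq_square)
  finally show ?thesis .
qed

text \<open>The constant 4 is the inverse square of the proportion 1/2 of primes that are guaranteed
  to contribute.\<close>

lemma root_sum_le:
  fixes \<alpha> :: nat
  assumes w: "\<And>n. w n \<ge> 0" "w summable_on UNIV"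
    and P: "finite \<P>" "\<P> \<noteq> {}" "\<And>p. p \<in> \<P> \<Longrightarrow> prime p" and "\<alpha> > 0"
    and few: "\<And>n. w n \<noteq> 0 \<Longrightarrow> 2 * card {p \<in> \<P>. int p dvd zeval g n * coeff_gcd d c n} \<le> card \<P>"
  shows "root_sum f w A \<le> 4 * (1 / (real (card \<P>))\<^sup>2 *
    (\<Sum>p\<in>\<P>. \<Sum>q\<in>\<P>. \<bar>\<Sum>i\<in>{0,1,2}. \<Sum>j\<in>{0,1,2}.
      sieve_coeff (real d) (real \<alpha>) i j * sieve_sum f (coeff_gcd d c) g w A i j p q\<bar>))"
    (is "_ \<le> 4 * (1 / ?P\<^sup>2 * ?S)")
proof -
  define T where "T p q = (\<Sum>i\<in>{0,1,2}. \<Sum>j\<in>{0,1,2}.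
      sieve_coeff (real d) (real \<alpha>) i j * sieve_sum f (coeff_gcd d c) g w A i j p q)" for p q
  define W where "W n = w n * (\<Sum>p\<in>\<P>. sieve_weight g \<alpha> p n)\<^sup>2" for n
  have P0: "?P > 0" using P by (simp add: card_gt_0_iff)
  have "((\<lambda>n. \<Sum>p\<in>\<P>. \<Sum>q\<in>\<P>. w n * (sieve_weight g \<alpha> p n * sieve_weight g \<alpha> q n))
      has_sum (\<Sum>p\<in>\<P>. \<Sum>q\<in>\<P>. T p q)) A"
    unfolding T_def by (intro has_sum_sum has_sum_sieve_weight w P)
  also have "(\<lambda>n. \<Sum>p\<in>\<P>. \<Sum>q\<in>\<P>. w n * (sieve_weight g \<alpha> p n * sieve_weight g \<alpha> q n)) = W"
    unfolding W_def power2_eq_square sum_product by (simp only: sum_distrib_left)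
  finally have W: "W summable_on A" "infsum W A = (\<Sum>p\<in>\<P>. \<Sum>q\<in>\<P>. T p q)"
    by (auto simp: has_sum_iff)
  have "root_sum f w A \<le> infsum (\<lambda>n. (4 / ?P\<^sup>2) * W n) A"
    unfolding root_sum_def
  \<comment> \<open>Terms of \<open>A\<close> without an integer root enter on the right only, where
    \<open>W\<close> is nonnegative because of the square.\<close>
  proof (rule infsum_mono_neutral)
    show "w summable_on {n \<in> A. \<exists>x. poly (specialise f n) x = 0}"
      using w(2) by (rule summable_on_subset) simp
    show "(\<lambda>n. (4 / ?P\<^sup>2) * W n) summable_on A" using W(1) by (rule summable_on_cmult_right)
    fix n assume "n \<in> {n \<in> A. \<exists>x. poly (specialise f n) x = 0} \<inter> A"
    then obtain x where x: "poly (specialise f n) x = 0" by blast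
    show "w n \<le> (4 / ?P\<^sup>2) * W n"
    proof (cases "w n = 0")
      case False
      have "(?P / 2)\<^sup>2 \<le> (\<Sum>p\<in>\<P>. sieve_weight g \<alpha> p n)\<^sup>2"
        using sum_sieve_weight_ge[OF P(1,3) x \<open>\<alpha> > 0\<close> few[OF False]] by (intro power_mono) auto
      then have "w n * (?P / 2)\<^sup>2 \<le> W n" unfolding W_def by (intro mult_left_mono w)
      then show ?thesis using P0 by (simp add: field_simps)
    qed (simp add: W_def)
  qed (auto simp: W_def w)
  also have "\<dots> = 4 * (1 / ?P\<^sup>2 * (\<Sum>p\<in>\<P>. \<Sum>q\<in>\<P>. T p q))"
    by (simp only: infsum_cmult_right' W)
  \<comment> \<open>Only the full double sum is known to be nonnegative; a single
    \<open>T p q\<close> may be negative, so absolute values enter last.\<close>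
  also have "\<dots> \<le> 4 * (1 / ?P\<^sup>2 * (\<Sum>p\<in>\<P>. \<Sum>q\<in>\<P>. \<bar>T p q\<bar>))"
    by (intro mult_left_mono sum_mono) auto
  finally show ?thesis unfolding T_def .
qed

end

section \<open>The sieve inequality\<close>

text \<open>The threshold \<open>P0\<close> excludes small sets whose primes may all divide
  g(n)h(n). For f = x, g the constant p, the single prime p, and \<open>w\<close> supported at 0
  with 0 in \<open>A\<close>, the right-hand side is 0 and the left-hand side is positive. The
  constant \<open>C\<close> is 4; the dependence on f, g and the norm sits in
  \<open>P0\<close>.\<close>

theorem theorem1:
  fixes f :: "'m::finite zpoly poly"
    and c :: "nat \<Rightarrow> 'm zpoly"
    and g :: "'m zpoly"
    and d :: nat
    and N :: "real ^ 'm \<Rightarrow> real"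
  assumes "f = (\<Sum>i\<le>d. monom (c i) (d - i))"
    and "c 0 \<noteq> 0"
    and "g \<noteq> 0"
    and "is_norm N"
  defines "h \<equiv> coeff_gcd d c"
  shows "\<exists>(C::real) (P0::nat). C > 0 \<and>
    (\<forall>(A :: (int ^ 'm) set) (w :: int ^ 'm \<Rightarrow> real) (\<P> :: nat set) (\<alpha> :: nat).
       (\<forall>n. w n \<ge> 0) \<longrightarrow>
       w summable_on UNIV \<longrightarrow>
       finite \<P> \<longrightarrow> \<P> \<noteq> {} \<longrightarrow> (\<forall>p\<in>\<P>. prime p) \<longrightarrow>
       card \<P> \<ge> P0 \<longrightarrow>
       \<alpha> > 0 \<longrightarrow>
       (\<forall>n. zeval g n * h n = 0 \<or> N (real_vec n) \<ge> exp (real (card \<P>)) \<longrightarrow> w n = 0) \<longrightarrow>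
       root_sum f w A \<le>
         C * (1 / (real (card \<P>))\<^sup>2 *
           (\<Sum>p\<in>\<P>. \<Sum>q\<in>\<P>.
              \<bar>\<Sum>i\<in>{0,1,2}. \<Sum>j\<in>{0,1,2}.
                 sieve_coeff (real d) (real \<alpha>) i j * sieve_sum f h g w A i j p q\<bar>)))"
proof -
  obtain K where K: "K > 0" "\<And>n T. T \<ge> 1 \<Longrightarrow> N (real_vec n) < exp T \<Longrightarrow>
      \<bar>real_of_int (zeval g n * h n)\<bar> \<le> exp (K * T)"
    using modulus_bound[OF assms(1,4)] unfolding h_def by metis
  obtain P0 :: nat where P0: "\<And>(T::nat) (M::int) Q. T \<ge> P0 \<Longrightarrow> M \<noteq> 0 \<Longrightarrow>
      \<bar>real_of_int M\<bar> \<le> exp (K * T) \<Longrightarrow> finite Q \<Longrightarrow>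
      (\<And>p. p \<in> Q \<Longrightarrow> prime p \<and> int p dvd M) \<Longrightarrow> 2 * card Q \<le> T"
    using few_prime_divisors[OF K(1)] by blast
  have "root_sum f w A \<le> 4 * (1 / (real (card \<P>))\<^sup>2 *
      (\<Sum>p\<in>\<P>. \<Sum>q\<in>\<P>. \<bar>\<Sum>i\<in>{0,1,2}. \<Sum>j\<in>{0,1,2}.
        sieve_coeff (real d) (real \<alpha>) i j * sieve_sum f h g w A i j p q\<bar>))"
    if w: "\<forall>n. w n \<ge> 0" "w summable_on UNIV"
      and P: "finite \<P>" "\<P> \<noteq> {}" "\<forall>p\<in>\<P>. prime p" "card \<P> \<ge> P0" and \<alpha>: "\<alpha> > 0"
      and supp: "\<forall>n. zeval g n * h n = 0 \<or> N (real_vec n) \<ge> exp (real (card \<P>)) \<longrightarrow> w n = 0"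
    for A w \<P> and \<alpha> :: nat
    unfolding h_def
  proof (rule root_sum_le[OF assms(1)])
    fix n assume "w n \<noteq> 0"
    then have n: "zeval g n * h n \<noteq> 0" "N (real_vec n) < exp (real (card \<P>))"
      using supp by (auto simp: not_le[symmetric])
    \<comment> \<open>Non-emptiness of the set of primes supplies the condition \<open>T\<close>
      \<ge> 1 of the size bound, taken at \<open>T = card\<close> of that set.\<close>
    have "real (card \<P>) \<ge> 1" using P(1,2) by (simp add: Suc_le_eq card_gt_0_iff)
    then have "\<bar>real_of_int (zeval g n * h n)\<bar> \<le> exp (K * card \<P>)" using n(2) by (rule K(2))
    then show "2 * card {p \<in> \<P>. int p dvd zeval g n * coeff_gcd d c n} \<le> card \<P>"
      using n(1) P unfolding h_def by (intro P0[of _ "zeval g n * coeff_gcd d c n"]) (blast | simp)+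
  qed (use w P \<alpha> in auto)
  then show ?thesis by (intro exI[of _ 4] exI[of _ P0]) auto
qed

end
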